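(* Let $H_1,H_2,H_4,H_5$ be Hilbert spaces over the same field ($\mathbb{R}$ or $\mathbb{C}$), let $A_1\in\mathcal{L}_c(H_1,H_4)$, $A_2\in\mathcal{L}_c(H_1,H_5)$, $B_1\in\mathcal{L}_c(H_2,H_4)$, $B_2\in\mathcal{L}_c(H_2,H_5)$, and let $A=(A_1,A_2):H_1\to H_4\times H_5$, $B=(B_1,B_2):H_2\to H_4\times H_5$. Assume that $$(B_2^* )^{-1}(\mathcal{R}(B_1^* ))=(B_2^* )^{-1}\big(\overline{\mathcal{R}(B_1^* )}\big).$$ Assume moreover that (i) or (ii) holds, where: (i) there exists $C>0$ such that for any $h_4\in H_4$, $\|A_1^*h_4\|_1\leqslant C\|B_1^*h_4\|_2$, and $\mathcal{N}(B^* )\subset\mathcal{N}(A^* )$, i.e. for all $(h_4,h_5)\in H_4\times H_5$, $B_1^*h_4+B_2^*h_5=0$ implies $A_1^*h_4+A_2^*h_5=0$; (ii) $A_1=B_1C_1$ for some $C_1\in\mathcal{L}_c(H_1,H_2)$ (or, equivalently, $A_1^*=D_1B_1^*$ for some $D_1\in\mathcal{L}_c(H_2,H_1)$), and $A^*=DB^*$ for some $D\in\mathcal{L}(H_2,H_1)$ not necessarily continuous. Then for any $h_1\in H_1$ and any $\varepsilon>0$, there exists $h_2\in H_2$ such that $A_1h_1=B_1h_2$ and $\|A_2h_1-B_2h_2\|_5\leqslant\varepsilon$.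
   Context: $\mathcal{L}_c(E,F)$ denotes the set of continuous linear maps from $E$ to $F$; $\mathcal{L}(E,F)$ denotes the set of all linear maps from $E$ to $F$, not necessarily continuous. $\mathcal{R}(T)$ is the range and $\mathcal{N}(T)$ the kernel of $T$, $T^*$ is the Hilbert space adjoint of $T$, $\overline{E}$ is the closure of $E$, and $\|\cdot\|_i$ is the norm of $H_i$. $(B_2^* )^{-1}(S)=\{h_5\in H_5: B_2^*h_5\in S\}$ denotes the preimage of $S\subset H_2$. The product $H_4\times H_5$ carries the Hilbertian norm $\|(h_4,h_5)\|^2=\|h_4\|_4^2+\|h_5\|_5^2$, so that $A^*(h_4,h_5)=A_1^*h_4+A_2^*h_5$ and $B^*(h_4,h_5)=B_1^*h_4+B_2^*h_5$. *)

theory Defs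
  imports "HOL-Analysis.Analysis"
begin

text \<open>
  The scalar fields \<open>\<real>\<close> and \<open>\<complex>\<close>, treated uniformly. The axioms on the conjugation \<open>kcnj\<close> admit
  no other models: see \<open>real_or_complex_cases\<close> below.
\<close>

class real_or_complex = real_normed_field +
  fixes kcnj :: "'a \<Rightarrow> 'a"
  assumes kcnj_add: "kcnj (x + y) = kcnj x + kcnj y"
    and kcnj_mult: "kcnj (x * y) = kcnj x * kcnj y"
    and mult_kcnj_scaleR: "x * kcnj x = (norm x)\<^sup>2 *\<^sub>R 1"

lemma mult_kcnj: "(x :: 'a::real_or_complex) * kcnj x = of_real ((norm x)\<^sup>2)"
  by (simp add: mult_kcnj_scaleR of_real_def)

instantiation real :: real_or_complex
begin
definition kcnj_real :: "real \<Rightarrow> real" where "kcnj_real x = x"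
instance by standard (auto simp: kcnj_real_def power2_eq_square)
end

instantiation complex :: real_or_complex
begin
definition kcnj_complex :: "complex \<Rightarrow> complex" where "kcnj_complex = cnj"
instance by standard (auto simp: kcnj_complex_def scaleR_conv_of_real complex_norm_square[symmetric])
end

lemma kcnj_of_real: "kcnj (of_real r :: 'a::real_or_complex) = of_real r"
proof (cases "r = 0")
  case True
  have "kcnj (0 + 0 :: 'a) = kcnj 0 + kcnj 0" by (rule kcnj_add)
  then show ?thesis using True by simp
next
  case False
  have "(of_real r :: 'a) * kcnj (of_real r) = of_real r * of_real r"
    by (simp add: mult_kcnj power2_eq_square flip: of_real_mult)
  then show ?thesis using False by simp
qed

lemma add_kcnj_real:
  fixes x :: "'a::real_or_complex"
  obtains t where "x + kcnj x = of_real t"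
proof
  have "kcnj 1 = (1::'a)" using kcnj_of_real[of 1, where 'a = 'a] by simp
  then have "(x + 1) * kcnj (x + 1) = x * kcnj x + (x + kcnj x) + 1"
    by (simp add: kcnj_add algebra_simps)
  then have "x + kcnj x = (x + 1) * kcnj (x + 1) - x * kcnj x - 1" by simp
  also have "\<dots> = of_real ((norm (x + 1))\<^sup>2 - (norm x)\<^sup>2 - 1)" by (simp only: mult_kcnj) simp
  finally show "x + kcnj x = of_real ((norm (x + 1))\<^sup>2 - (norm x)\<^sup>2 - 1)" .
qed

lemma real_or_complex_quadratic:
  fixes x :: "'a::real_or_complex"
  assumes "x \<notin> \<real>"
  obtains a b u where "x = of_real a + of_real b * u" "u\<^sup>2 = -1" "b \<noteq> 0"
proof -
  obtain t where t: "x + kcnj x = of_real t" by (rule add_kcnj_real)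
  define d where "d = t\<^sup>2 / 4 - (norm x)\<^sup>2"
  define y where "y = x - of_real (t / 2)"
  have "x * (of_real t - x) = of_real ((norm x)\<^sup>2)"
    using mult_kcnj[of x] t by (metis add_diff_cancel_left')
  then have "x\<^sup>2 = of_real t * x - of_real ((norm x)\<^sup>2)"
    by (simp add: algebra_simps power2_eq_square)
  moreover have "of_real t = (of_real (t / 2) + of_real (t / 2) :: 'a)"
    by (simp flip: of_real_add)
  ultimately have "y\<^sup>2 = (of_real (t / 2))\<^sup>2 - of_real ((norm x)\<^sup>2)"
    unfolding y_def by (simp add: power2_eq_square algebra_simps del: of_real_divide of_real_mult)
  then have y2: "y\<^sup>2 = of_real d"
    unfolding d_def by (simp add: power_divide)
  have "d < 0"
  proof (rule ccontr)
    assume "\<not> d < 0"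
    then have "y\<^sup>2 = (of_real (sqrt d))\<^sup>2" using y2 by (simp flip: of_real_power)
    then have "y = of_real (sqrt d) \<or> y = - of_real (sqrt d)" by (simp add: power2_eq_iff)
    then have "y \<in> \<real>" by auto
    moreover have "x = y + of_real (t / 2)" by (simp add: y_def)
    ultimately show False using assms by (metis Reals_add Reals_of_real)
  qed
  define b where "b = sqrt (- d)"
  have b: "b \<noteq> 0" "b\<^sup>2 = - d" using \<open>d < 0\<close> by (auto simp: b_def)
  have "(y / of_real b)\<^sup>2 = of_real d / of_real (b\<^sup>2)" by (simp add: power_divide y2)
  also have "\<dots> = -1" using \<open>d < 0\<close> by (simp add: b(2))
  finally have "(y / of_real b)\<^sup>2 = -1" .
  moreover have "x = of_real (t / 2) + of_real b * (y / of_real b)" using b by (simp add: y_def)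
  ultimately show thesis using b that by blast
qed

lemma real_or_complex_cases:
  "(\<forall>x::'a::real_or_complex. x \<in> \<real> \<and> kcnj x = x) \<or>
   (\<exists>u::'a. u\<^sup>2 = -1 \<and> kcnj u = - u \<and> (\<forall>x. \<exists>a b. x = of_real a + of_real b * u))"
proof (cases "\<forall>x::'a. x \<in> \<real>")
  case True
  then show ?thesis by (metis Reals_cases kcnj_of_real)
next
  case False
  then obtain u :: 'a where u: "u\<^sup>2 = -1" using real_or_complex_quadratic by metis
  have "(norm u)\<^sup>2 = 1" using u by (metis norm_minus_cancel norm_one norm_power)
  then have "u * kcnj u = u * (- u)" using u by (simp add: mult_kcnj power2_eq_square)
  moreover have "u \<noteq> 0" using u by auto
  ultimately have ku: "kcnj u = - u" by (metis mult_cancel_left)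
  have "\<exists>a b. x = of_real a + of_real b * u" for x
  proof (cases "x \<in> \<real>")
    case True
    then obtain r where "x = of_real r + of_real 0 * u" by (auto elim: Reals_cases)
    then show ?thesis by blast
  next
    case False
    then obtain a b v where v: "x = of_real a + of_real b * v" "v\<^sup>2 = -1"
      by (rule real_or_complex_quadratic)
    then have "v = u \<or> v = - u" using u by (metis power2_eq_iff)
    then show ?thesis using v(1) by (metis mult_minus_left mult_minus_right of_real_minus)
  qed
  then show ?thesis using u ku by blast
qed

text \<open>
  A Hilbert space over \<open>'k\<close> is a complete normed space whose norm comes from a \<open>'k\<close>-valued inner
  product (linear in the first argument, conjugate-linear in the second). The type class \<open>banach\<close>
  provides norm, topology and real scaling; the \<open>'k\<close>-scaling extends the latter.
\<close>

locale hilbert_space = vector_space scale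
  for scale :: "'k::real_or_complex \<Rightarrow> 'a::banach \<Rightarrow> 'a" +
  fixes ip :: "'a \<Rightarrow> 'a \<Rightarrow> 'k"
  assumes scale_of_real: "scale (of_real r) x = r *\<^sub>R x"
    and ip_add_left: "ip (x + y) z = ip x z + ip y z"
    and ip_scale_left: "ip (scale c x) y = c * ip x y"
    and ip_commute: "ip y x = kcnj (ip x y)"
    and ip_self: "ip x x = of_real ((norm x)\<^sup>2)"

definition continuous_linear ::
  "('k::field \<Rightarrow> 'a::real_normed_vector \<Rightarrow> 'a) \<Rightarrow> ('k \<Rightarrow> 'b::real_normed_vector \<Rightarrow> 'b)
    \<Rightarrow> ('a \<Rightarrow> 'b) \<Rightarrow> bool"
  where "continuous_linear s1 s2 T \<longleftrightarrow> Vector_Spaces.linear s1 s2 T \<and> continuous_on UNIV T"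

text \<open>
  As for \<^const>\<open>adjoint\<close>, the defining identity holds only where such a map exists, in particular for
  \<open>T\<close> continuous linear between Hilbert spaces.
\<close>

definition hilbert_adjoint ::
  "('a \<Rightarrow> 'a \<Rightarrow> 'k) \<Rightarrow> ('b \<Rightarrow> 'b \<Rightarrow> 'k) \<Rightarrow> ('a \<Rightarrow> 'b) \<Rightarrow> 'b \<Rightarrow> 'a"
  where "hilbert_adjoint ip1 ip2 T = (SOME S. \<forall>x y. ip2 (T x) y = ip1 x (S y))"

text \<open>The library norm on the product type is already the Hilbertian one.\<close>

definition prod_ip ::
  "('a \<Rightarrow> 'a \<Rightarrow> 'k::plus) \<Rightarrow> ('b \<Rightarrow> 'b \<Rightarrow> 'k) \<Rightarrow> 'a \<times> 'b \<Rightarrow> 'a \<times> 'b \<Rightarrow> 'k"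
  where "prod_ip ip1 ip2 p q = ip1 (fst p) (fst q) + ip2 (snd p) (snd q)"

definition prod_scale ::
  "('k \<Rightarrow> 'a \<Rightarrow> 'a) \<Rightarrow> ('k \<Rightarrow> 'b \<Rightarrow> 'b) \<Rightarrow> 'k \<Rightarrow> 'a \<times> 'b \<Rightarrow> 'a \<times> 'b"
  where "prod_scale s1 s2 c p = (s1 c (fst p), s2 c (snd p))"

lemma hilbert_space_prod:
  assumes "hilbert_space s1 ip1" and "hilbert_space s2 ip2"
  shows "hilbert_space (prod_scale s1 s2) (prod_ip ip1 ip2)"
proof -
  interpret H1: hilbert_space s1 ip1 by fact
  interpret H2: hilbert_space s2 ip2 by fact
  show ?thesis
  proof unfold_locales
    fix x y
    show "prod_ip ip1 ip2 y x = kcnj (prod_ip ip1 ip2 x y)"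
      unfolding prod_ip_def kcnj_add
      using H1.ip_commute[of "fst y" "fst x"] H2.ip_commute[of "snd y" "snd x"] by simp
  qed (auto simp: prod_ip_def prod_scale_def prod_eq_iff norm_prod_def
      H1.scale_right_distrib H2.scale_right_distrib H1.scale_left_distrib H2.scale_left_distrib
      H1.scale_of_real H2.scale_of_real H1.ip_add_left H2.ip_add_left
      H1.ip_scale_left H2.ip_scale_left H1.ip_self H2.ip_self algebra_simps)
qed

lemma hilbert_space_real:
  "hilbert_space (scaleR :: real \<Rightarrow> 'a \<Rightarrow> 'a) (inner :: 'a::{real_inner,banach} \<Rightarrow> 'a \<Rightarrow> real)"
  by unfold_locales
    (auto simp: kcnj_real_def inner_commute inner_add_left power2_norm_eq_inner algebra_simps)

lemma hilbert_space_complex: "hilbert_space (*) (\<lambda>x y :: complex. x * cnj y)"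
  by unfold_locales
    (auto simp: kcnj_complex_def scaleR_conv_of_real algebra_simps simp flip: complex_norm_square)

end

theory Submission
  imports Defs
begin

text \<open>
  Fix \<open>h\<^sub>1\<close>. Controlling \<open>A\<^sub>1\<^sup>*\<close> by \<open>B\<^sub>1\<^sup>*\<close> gives an exact solution \<open>g\<close> of \<open>B\<^sub>1 g = A\<^sub>1 h\<^sub>1\<close>: the map
  \<open>B\<^sub>1\<^sup>* h\<^sub>4 \<mapsto> \<langle>A\<^sub>1\<^sup>* h\<^sub>4, h\<^sub>1\<rangle>\<close> is a bounded functional on the range of \<open>B\<^sub>1\<^sup>*\<close>, and \<open>g\<close> is a vector
  representing it (\<open>range_subset_if_adj_dominated\<close>). All exact solutions are then \<open>g + n\<close> with
  \<open>n \<in> \<N>(B\<^sub>1)\<close>, so the claim is that \<open>A\<^sub>2 h\<^sub>1 - B\<^sub>2 g\<close> lies in the closure of \<open>B\<^sub>2(\<N>(B\<^sub>1))\<close>.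

  By duality this means that each \<open>h\<^sub>5\<close> orthogonal to \<open>B\<^sub>2(\<N>(B\<^sub>1))\<close> is orthogonal to
  \<open>A\<^sub>2 h\<^sub>1 - B\<^sub>2 g\<close>. For such \<open>h\<^sub>5\<close>, the vector \<open>B\<^sub>2\<^sup>* h\<^sub>5\<close> is orthogonal to \<open>\<N>(B\<^sub>1)\<close>, that is, it lies in
  the closure of the range of \<open>B\<^sub>1\<^sup>*\<close> (\<open>mem_closure_image_kernel\<close>). The hypothesis on preimages removes
  the closure: \<open>B\<^sub>2\<^sup>* h\<^sub>5 = - B\<^sub>1\<^sup>* h\<^sub>4\<close> for some \<open>h\<^sub>4\<close>, so \<open>B\<^sup>*(h\<^sub>4, h\<^sub>5) = 0\<close>, hence
  \<open>A\<^sup>*(h\<^sub>4, h\<^sub>5) = 0\<close>. Therefore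
  \<open>\<langle>h\<^sub>5, A\<^sub>2 h\<^sub>1 - B\<^sub>2 g\<rangle> = - \<langle>A\<^sub>1\<^sup>* h\<^sub>4, h\<^sub>1\<rangle> + \<langle>B\<^sub>1\<^sup>* h\<^sub>4, g\<rangle> = \<langle>h\<^sub>4, B\<^sub>1 g - A\<^sub>1 h\<^sub>1\<rangle> = 0\<close>
  (\<open>approximate_solution\<close>).

  Alternatives (i) and (ii) both provide the two ingredients used here: \<open>\<R>(A\<^sub>1) \<subseteq> \<R>(B\<^sub>1)\<close> and
  \<open>\<N>(B\<^sup>*) \<subseteq> \<N>(A\<^sup>*)\<close>.
\<close>

section \<open>Geometry of Hilbert spaces over the reals or the complex numbers\<close>

context hilbert_space
begin

lemma ip_self_eq_zero [simp]: "ip x x = 0 \<longleftrightarrow> x = 0"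
  by (simp add: ip_self)

lemma ip_zero_left [simp]: "ip 0 y = 0"
  using ip_scale_left[of 0 0 y] by simp

lemma ip_diff_left: "ip (x - y) z = ip x z - ip y z"
  using ip_add_left[of "x - y" y z] by simp

lemma ip_add_right: "ip x (y + z) = ip x y + ip x z"
  using ip_commute[of x "y + z"] ip_commute[of x y] ip_commute[of x z]
  by (simp add: ip_add_left kcnj_add)

lemma ip_diff_right: "ip x (y - z) = ip x y - ip x z"
  using ip_add_right[of x "y - z" z] by simp

lemma ip_scale_right: "ip x (scale c y) = kcnj c * ip x y"
  using ip_commute[of x "scale c y"] ip_commute[of x y] by (simp add: ip_scale_left kcnj_mult)

lemma ip_eq_zero_commute: "ip x y = 0 \<longleftrightarrow> ip y x = 0"
  using ip_commute[of x y] ip_commute[of y x] kcnj_of_real[of 0, where 'a = 'k] by auto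

lemma ip_zero_right [simp]: "ip y 0 = 0"
  using ip_eq_zero_commute[of y 0] by simp

lemma eqI_ip_right:
  assumes "\<And>z. ip z x = ip z y"
  shows "x = y"
  using assms[of "x - y"] ip_self_eq_zero[of "x - y"] by (simp add: ip_diff_right)

lemma linear_ip_left: "Vector_Spaces.linear scale (*) (\<lambda>x. ip x y)"
  by unfold_locales (auto simp: ip_add_left ip_scale_left algebra_simps)

lemma norm_scale: "norm (scale c x) = norm c * norm x"
proof -
  have "of_real ((norm (scale c x))\<^sup>2) = (c * kcnj c) * ip x x"
    by (simp only: ip_self[symmetric]) (simp add: ip_scale_left ip_scale_right)
  also have "\<dots> = of_real ((norm c * norm x)\<^sup>2)"
    by (simp only: mult_kcnj ip_self) (simp add: power_mult_distrib)
  finally show ?thesis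
    by (simp only: of_real_eq_iff) simp
qed

text \<open>
  Pythagoras for \<open>z\<close> and its component along \<open>y\<close>. The formula gives the Cauchy-Schwarz inequality,
  and it also shows, for real and complex scalars alike, that a nearest point in a subspace is an
  orthogonal projection.
\<close>

lemma norm_diff_component:
  assumes "y \<noteq> 0"
  shows "(norm (z - scale (ip z y / ip y y) y))\<^sup>2 = (norm z)\<^sup>2 - (norm (ip z y))\<^sup>2 / (norm y)\<^sup>2"
proof -
  define c where "c = ip z y / ip y y"
  have c: "c * ip y y = ip z y" using assms by (simp add: c_def)
  have "of_real ((norm (z - scale c y))\<^sup>2) = ip z z - c * ip y z"
    using c by (simp only: ip_self[symmetric])
      (simp add: ip_diff_left ip_diff_right ip_scale_left ip_scale_right algebra_simps)
  also have "c * ip y z = ip z y * kcnj (ip z y) / ip y y"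
    by (simp add: c_def ip_commute[of y z])
  also have "ip z z - \<dots> = of_real ((norm z)\<^sup>2 - (norm (ip z y))\<^sup>2 / (norm y)\<^sup>2)"
    by (simp only: mult_kcnj ip_self) simp
  finally show ?thesis
    unfolding c_def by (simp only: of_real_eq_iff)
qed

lemma Cauchy_Schwarz: "norm (ip x y) \<le> norm x * norm y"
proof (cases "y = 0")
  case False
  then have "(norm (ip x y))\<^sup>2 / (norm y)\<^sup>2 \<le> (norm x)\<^sup>2"
    using norm_diff_component[of y x] by (metis diff_ge_0_iff_ge zero_le_power2)
  then have "(norm (ip x y))\<^sup>2 \<le> (norm x * norm y)\<^sup>2"
    using False by (simp add: divide_simps power_mult_distrib)
  then show ?thesis by (rule power2_le_imp_le) simp
qed simp

lemma parallelogram: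
  fixes x y :: 'a
  shows "(norm (x + y))\<^sup>2 + (norm (x - y))\<^sup>2 = 2 * (norm x)\<^sup>2 + 2 * (norm y)\<^sup>2"
proof -
  have "of_real ((norm (x + y))\<^sup>2 + (norm (x - y))\<^sup>2)
      = ip (x + y) (x + y) + ip (x - y) (x - y)"
    by (simp add: ip_self)
  also have "\<dots> = 2 * ip x x + 2 * ip y y"
    by (simp add: ip_add_left ip_add_right ip_diff_left ip_diff_right algebra_simps)
  also have "\<dots> = of_real (2 * (norm x)\<^sup>2 + 2 * (norm y)\<^sup>2)"
    by (simp add: ip_self)
  finally show ?thesis by (simp only: of_real_eq_iff)
qed

lemma subspace_closure:
  assumes "subspace S"
  shows "subspace (closure S)"
proof (rule subspaceI)
  show "0 \<in> closure S" using subspace_0[OF assms] closure_subset by blast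
next
  fix x y assume "x \<in> closure S" "y \<in> closure S"
  then obtain u v where "\<And>n. u n \<in> S" "u \<longlonglongrightarrow> x" "\<And>n. v n \<in> S" "v \<longlonglongrightarrow> y"
    unfolding closure_sequential by blast
  then have "\<forall>n. u n + v n \<in> S" "(\<lambda>n. u n + v n) \<longlonglongrightarrow> x + y"
    by (auto intro: tendsto_add subspace_add[OF assms])
  then show "x + y \<in> closure S"
    unfolding closure_sequential by (intro exI[of _ "\<lambda>n. u n + v n"] conjI)
next
  fix c :: 'k and x assume "x \<in> closure S"
  then obtain u where u: "\<And>n. u n \<in> S" "u \<longlonglongrightarrow> x"
    unfolding closure_sequential by blast
  have "(\<lambda>n. norm c * norm (u n - x)) \<longlonglongrightarrow> norm c * 0"
    using u(2) by (intro tendsto_mult tendsto_const) (simp add: LIM_zero tendsto_norm_zero)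
  then have "(\<lambda>n. norm (scale c (u n) - scale c x)) \<longlonglongrightarrow> 0"
    by (simp only: norm_scale[symmetric] scale_right_diff_distrib mult_zero_right)
  then have "(\<lambda>n. scale c (u n)) \<longlonglongrightarrow> scale c x"
    by (rule LIM_zero_cancel[OF tendsto_norm_zero_cancel])
  then show "scale c x \<in> closure S"
    unfolding closure_sequential using subspace_scale[OF assms u(1)]
    by (intro exI[of _ "\<lambda>n. scale c (u n)"] conjI allI)
qed

text \<open>
  The parallelogram law makes a minimising sequence for the distance to \<open>x\<close> a Cauchy sequence; its
  limit is a nearest point \<open>q\<close>. If some \<open>y\<close> in the subspace were not orthogonal to \<open>x - q\<close>, moving
  \<open>q\<close> by the component of \<open>x - q\<close> along \<open>y\<close> would bring it closer to \<open>x\<close>.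
\<close>

lemma orthogonal_projection:
  assumes M: "subspace M" "closed M"
  obtains p where "p \<in> M" "\<And>y. y \<in> M \<Longrightarrow> ip y (x - p) = 0"
proof -
  define D where "D = (INF y\<in>M. (norm (x - y))\<^sup>2)"
  have M0: "M \<noteq> {}" using subspace_0[OF M(1)] by blast
  have bdd: "bdd_below ((\<lambda>y. (norm (x - y))\<^sup>2) ` M)" by (rule bdd_belowI[of _ 0]) auto
  have D: "D \<le> (norm (x - y))\<^sup>2" if "y \<in> M" for y
    unfolding D_def by (rule cINF_lower[OF bdd that])
  have "\<exists>y\<in>M. (norm (x - y))\<^sup>2 < D + 1 / real (Suc n)" for n
    using cINF_less_iff[OF M0 bdd, of "D + 1 / real (Suc n)"] by (simp add: D_def[symmetric])
  then obtain p where p: "\<And>n. p n \<in> M" "\<And>n. (norm (x - p n))\<^sup>2 < D + 1 / real (Suc n)"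
    by metis
  have close: "(norm (p m - p n))\<^sup>2 \<le> 2 / real (Suc m) + 2 / real (Suc n)" for m n
  proof -
    have mid: "scale (of_real (1/2)) (p m + p n) \<in> M"
      using p(1) M(1) by (intro subspace_scale subspace_add)
    have "(x - p m) + (x - p n) = 2 *\<^sub>R (x - scale (of_real (1/2)) (p m + p n))"
      unfolding scale_of_real by (simp add: algebra_simps scaleR_2)
    then have "(norm ((x - p m) + (x - p n)))\<^sup>2
        = 4 * (norm (x - scale (of_real (1/2)) (p m + p n)))\<^sup>2"
      by (simp add: power_mult_distrib)
    moreover note D[OF mid]
    moreover have "norm ((x - p m) - (x - p n)) = norm (p m - p n)"
      by (simp add: norm_minus_commute)
    ultimately show ?thesis
      using parallelogram[of "x - p m" "x - p n"] p(2)[of m] p(2)[of n] by simp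
  qed
  have "Cauchy p"
  proof (rule CauchyI)
    fix e :: real assume "e > 0"
    then obtain N where N: "inverse (real (Suc N)) < e\<^sup>2 / 4"
      using reals_Archimedean[of "e\<^sup>2 / 4"] by auto
    have "norm (p m - p n) < e" if "m \<ge> N" "n \<ge> N" for m n
    proof (rule power2_less_imp_less)
      have *: "1 / real (Suc k) \<le> inverse (real (Suc N))" if "k \<ge> N" for k
        using that by (simp add: field_simps)
      from *[OF that(1)] *[OF that(2)] show "(norm (p m - p n))\<^sup>2 < e\<^sup>2"
        using close[of m n] N by simp
    qed (use \<open>e > 0\<close> in simp)
    then show "\<exists>N. \<forall>m\<ge>N. \<forall>n\<ge>N. norm (p m - p n) < e" by blast
  qed
  then obtain q where q: "p \<longlonglongrightarrow> q" by (auto simp: Cauchy_convergent_iff convergent_def)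
  have qM: "q \<in> M" using closed_sequentially[OF M(2) p(1) q] .
  have "(\<lambda>n. (norm (x - p n))\<^sup>2) \<longlonglongrightarrow> (norm (x - q))\<^sup>2"
    using q by (intro tendsto_intros)
  moreover have "(\<lambda>n. D + 1 / real (Suc n)) \<longlonglongrightarrow> D + 0"
    by (intro tendsto_add tendsto_const LIMSEQ_Suc[OF lim_1_over_n])
  ultimately have "(norm (x - q))\<^sup>2 \<le> D + 0"
    by (rule LIMSEQ_le) (use p(2) less_imp_le in blast)
  then have nearest: "(norm (x - q))\<^sup>2 \<le> (norm (x - y))\<^sup>2" if "y \<in> M" for y
    using D[OF that] by linarith
  have "ip y (x - q) = 0" if y: "y \<in> M" for y
  proof (cases "y = 0")
    case False
    define c where "c = ip (x - q) y / ip y y"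
    have "(norm (x - q))\<^sup>2 \<le> (norm (x - (q + scale c y)))\<^sup>2"
      by (intro nearest subspace_add subspace_scale M qM y)
    also have "x - (q + scale c y) = (x - q) - scale c y" by simp
    also have "(norm \<dots>)\<^sup>2 = (norm (x - q))\<^sup>2 - (norm (ip (x - q) y))\<^sup>2 / (norm y)\<^sup>2"
      unfolding c_def by (rule norm_diff_component[OF False])
    finally have "(norm (ip (x - q) y))\<^sup>2 / (norm y)\<^sup>2 \<le> 0" by simp
    then have "ip (x - q) y = 0" using False by (simp add: divide_simps)
    then show ?thesis by (simp add: ip_eq_zero_commute)
  qed simp
  with qM that show thesis by blast
qed

text \<open>
  The inclusion \<open>S\<^sup>\<bottom>\<^sup>\<bottom> \<subseteq> closure S\<close>, the form in which completeness is used below: the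
  residual of the projection of \<open>x\<close> onto \<open>closure S\<close> is itself orthogonal to \<open>S\<close>.
\<close>

lemma mem_closure_if_orthogonal:
  assumes S: "subspace S"
    and orth: "\<And>z. (\<And>y. y \<in> S \<Longrightarrow> ip y z = 0) \<Longrightarrow> ip x z = 0"
  shows "x \<in> closure S"
proof -
  obtain p where p: "p \<in> closure S" "\<And>y. y \<in> closure S \<Longrightarrow> ip y (x - p) = 0"
    using orthogonal_projection[OF subspace_closure[OF S] closed_closure] by metis
  have "ip x (x - p) = 0"
    using p(2) closure_subset[of S] by (intro orth) blast
  with p(2)[OF p(1)] have "ip (x - p) (x - p) = 0" by (simp add: ip_diff_left)
  with p(1) show ?thesis by simp
qed

text \<open>
  The Riesz representation theorem for the functional \<open>T v \<mapsto> f v\<close> on the range of \<open>T\<close>. Stating it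
  in terms of \<open>v\<close> avoids both the well-definedness of that functional and its extension to the
  closure of the range. With \<open>T = id\<close> it is the usual theorem, which yields adjoints; with \<open>T\<close> an
  adjoint operator it solves operator equations.

  For the proof, normalise \<open>f v\<^sub>0 = 1\<close>. The bound keeps \<open>T v\<^sub>0\<close> away from the image of the kernel of
  \<open>f\<close>, so some \<open>z\<close> orthogonal to that image is not orthogonal to \<open>T v\<^sub>0\<close>. Since
  \<open>v - f(v) v\<^sub>0\<close> is in the kernel of \<open>f\<close>, a multiple of \<open>z\<close> represents the functional.
\<close>

lemma riesz_representation_dominated:
  fixes T :: "'c::ab_group_add \<Rightarrow> 'a" and f :: "'c \<Rightarrow> 'k"
  assumes T: "Vector_Spaces.linear s scale T" and f: "Vector_Spaces.linear s (*) f"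
    and bound: "\<And>v. norm (f v) \<le> K * norm (T v)"
  obtains w where "\<And>v. f v = ip (T v) w"
proof (cases "\<forall>v. f v = 0")
  case True
  then show thesis by (intro that[of 0]) simp
next
  case False
  interpret T: Vector_Spaces.linear s scale T by fact
  interpret f: Vector_Spaces.linear s "(*)" f by fact
  obtain u where u: "f u \<noteq> 0" using False by blast
  define v0 where "v0 = s (1 / f u) u"
  have fv0: "f v0 = 1" using u by (simp add: v0_def f.scale)
  define R where "R = T ` {v. f v = 0}"
  have R: "subspace R"
    unfolding R_def by (intro T.subspace_image f.subspace_kernel)
  have "T v0 \<notin> closure R"
  proof
    assume "T v0 \<in> closure R"
    \<comment> \<open>The radius \<open>1 / K\<close>, adjusted to make sense also for \<open>K \<le> 0\<close>.\<close>
    moreover have "0 < 1 / (\<bar>K\<bar> + 1)" by simp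
    ultimately obtain v where v: "f v = 0" "dist (T v) (T v0) < 1 / (\<bar>K\<bar> + 1)"
      unfolding closure_approachable R_def by blast
    have "1 = norm (f (v - v0))" by (simp add: f.diff v fv0)
    also have "\<dots> \<le> K * norm (T v - T v0)" using bound[of "v - v0"] by (simp add: T.diff)
    also have "\<dots> \<le> (\<bar>K\<bar> + 1) * norm (T v - T v0)" by (intro mult_right_mono) auto
    also have "\<dots> < 1" using v(2) by (simp add: dist_norm field_simps)
    finally show False by simp
  qed
  then obtain z where z: "\<And>y. y \<in> R \<Longrightarrow> ip y z = 0" "ip (T v0) z \<noteq> 0"
    using mem_closure_if_orthogonal[OF R] by blast
  have fz: "ip (T v) z = f v * ip (T v0) z" for v
  proof -
    have "T (v - s (f v) v0) \<in> R" unfolding R_def by (simp add: f.diff f.scale fv0)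
    from z(1)[OF this] show ?thesis by (simp add: T.diff T.scale ip_diff_left ip_scale_left)
  qed
  define c where "c = 1 / ip z (T v0)"
  have "ip z (T v0) \<noteq> 0" using z(2) by (simp add: ip_eq_zero_commute)
  then have "c * ip z (T v0) = of_real 1" by (simp add: c_def)
  then have "kcnj c * ip (T v0) z = of_real 1"
    using kcnj_mult[of c "ip z (T v0)"] by (simp only: ip_commute[of "T v0" z] kcnj_of_real)
  then have "ip (T v) (scale c z) = f v" for v
    unfolding ip_scale_right fz[of v] by (simp add: mult.left_commute)
  then show thesis using that by metis
qed

end

section \<open>Continuous linear operators and their adjoints\<close>

lemma continuous_linear_bounded:
  assumes "hilbert_space s1 ip1" "hilbert_space s2 ip2" "continuous_linear s1 s2 T"
  obtains K where "K > 0" "\<And>x. norm (T x) \<le> K * norm x"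
proof -
  interpret H1: hilbert_space s1 ip1 by fact
  interpret H2: hilbert_space s2 ip2 by fact
  interpret T: Vector_Spaces.linear s1 s2 T
    using assms(3) by (simp add: continuous_linear_def)
  have "isCont T 0"
    using assms(3) by (simp add: continuous_linear_def continuous_on_eq_continuous_at)
  then obtain d where d: "d > 0" "\<And>x. norm x < d \<Longrightarrow> norm (T x) < 1"
    unfolding continuous_at_eps_delta using zero_less_one
    by (metis T.zero dist_0_norm dist_commute)
  have "norm (T x) \<le> 2 / d * norm x" for x
  proof (cases "x = 0")
    case False
    define r where "r = d / (2 * norm x)"
    have r: "r > 0" using False d(1) by (simp add: r_def)
    have "norm (r *\<^sub>R x) < d" using False d(1) by (simp add: r_def)
    then have "norm (T (r *\<^sub>R x)) < 1" by (rule d(2))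
    moreover have "T (r *\<^sub>R x) = r *\<^sub>R T x"
      using T.scale[of "of_real r" x] by (simp add: H1.scale_of_real H2.scale_of_real)
    ultimately have "r * norm (T x) < 1" using r by simp
    then show ?thesis using False d(1) by (simp add: r_def field_simps)
  qed simp
  with d(1) show thesis by (intro that[of "2 / d"]) auto
qed

lemma hilbert_adjoint_unique:
  assumes "hilbert_space s1 ip1" "\<And>x y. ip2 (T x) y = ip1 x (S y)"
  shows "hilbert_adjoint ip1 ip2 T = S"
proof -
  interpret H1: hilbert_space s1 ip1 by fact
  have "\<forall>x y. ip2 (T x) y = ip1 x (hilbert_adjoint ip1 ip2 T y)"
    unfolding hilbert_adjoint_def by (rule someI[of _ S]) (use assms(2) in blast)
  then have "ip1 x (hilbert_adjoint ip1 ip2 T y) = ip1 x (S y)" for x y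
    using assms(2) by metis
  then show ?thesis by (intro ext H1.eqI_ip_right)
qed

locale hilbert_operator =
  dom: hilbert_space s1 ip1 + cod: hilbert_space s2 ip2
  for s1 :: "'k::real_or_complex \<Rightarrow> 'a::banach \<Rightarrow> 'a" and ip1
    and s2 :: "'k \<Rightarrow> 'b::banach \<Rightarrow> 'b" and ip2 +
  fixes T :: "'a \<Rightarrow> 'b"
  assumes continuous_linear: "continuous_linear s1 s2 T"
begin

abbreviation adj :: "'b \<Rightarrow> 'a" where "adj \<equiv> hilbert_adjoint ip1 ip2 T"

sublocale Vector_Spaces.linear s1 s2 T
  using continuous_linear by (simp add: continuous_linear_def)

lemma ip_adj_right: "ip1 x (adj y) = ip2 (T x) y"
proof -
  obtain K where K: "K > 0" "\<And>x. norm (T x) \<le> K * norm x"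
    using continuous_linear_bounded dom.hilbert_space_axioms cod.hilbert_space_axioms
      continuous_linear by blast
  have "\<exists>w. \<forall>x. ip2 (T x) y = ip1 x w" for y
  proof -
    have "Vector_Spaces.linear s1 (*) ((\<lambda>z. ip2 z y) \<circ> T)"
      by (rule Vector_Spaces.linear_compose[OF linear_axioms cod.linear_ip_left])
    moreover have "norm (((\<lambda>z. ip2 z y) \<circ> T) x) \<le> (K * norm y) * norm (id x)" for x
    proof -
      have "norm (ip2 (T x) y) \<le> norm (T x) * norm y" by (rule cod.Cauchy_Schwarz)
      also have "\<dots> \<le> (K * norm x) * norm y" by (intro mult_right_mono K(2)) simp
      finally show ?thesis by (simp add: mult_ac)
    qed
    ultimately obtain w where "\<And>x. ((\<lambda>z. ip2 z y) \<circ> T) x = ip1 (id x) w"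
      using dom.riesz_representation_dominated[OF dom.linear_id] by metis
    then show ?thesis by auto
  qed
  then obtain S where "\<And>x y. ip2 (T x) y = ip1 x (S y)" by metis
  then show ?thesis
    using hilbert_adjoint_unique[OF dom.hilbert_space_axioms, of ip2 T S] by simp
qed

lemma ip_adj_left: "ip1 (adj y) x = ip2 y (T x)"
  unfolding dom.ip_commute[of "adj y" x] cod.ip_commute[of y "T x"] ip_adj_right ..

lemma linear_adj: "Vector_Spaces.linear s2 s1 adj"
proof unfold_locales
  show "adj (x + y) = adj x + adj y" for x y
    by (rule dom.eqI_ip_right) (simp add: ip_adj_right dom.ip_add_right cod.ip_add_right)
  show "adj (s2 c x) = s1 c (adj x)" for c x
    by (rule dom.eqI_ip_right) (simp add: ip_adj_right dom.ip_scale_right cod.ip_scale_right)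
qed

lemma subspace_range_adj: "dom.subspace (range adj)"
proof -
  interpret adj: Vector_Spaces.linear s2 s1 adj by (rule linear_adj)
  show ?thesis by (intro adj.subspace_image cod.subspace_UNIV)
qed

end

lemma hilbert_operatorI:
  assumes "hilbert_space s1 ip1" "hilbert_space s2 ip2" "continuous_linear s1 s2 T"
  shows "hilbert_operator s1 ip1 s2 ip2 T"
  using assms by (simp add: hilbert_operator_def hilbert_operator_axioms_def)

lemma hilbert_adjoint_Pair:
  assumes "hilbert_operator s ip s4 ip4 T1" "hilbert_operator s ip s5 ip5 T2"
  shows "hilbert_adjoint ip (prod_ip ip4 ip5) (\<lambda>x. (T1 x, T2 x))
    = (\<lambda>p. hilbert_adjoint ip ip4 T1 (fst p) + hilbert_adjoint ip ip5 T2 (snd p))"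
proof -
  interpret T1: hilbert_operator s ip s4 ip4 T1 by fact
  interpret T2: hilbert_operator s ip s5 ip5 T2 by fact
  show ?thesis
    by (rule hilbert_adjoint_unique[OF T1.dom.hilbert_space_axioms])
      (simp add: prod_ip_def T1.dom.ip_add_right T1.ip_adj_right T2.ip_adj_right)
qed

section \<open>Solving operator equations by duality\<close>

text \<open>
  One half of Douglas' range inclusion theorem: a vector \<open>w\<close> representing
  \<open>B\<^sup>* y \<mapsto> \<langle>A\<^sup>* y, x\<rangle>\<close> satisfies \<open>\<langle>y, B w\<rangle> = \<langle>y, A x\<rangle>\<close> for all \<open>y\<close>.
\<close>

lemma range_subset_if_adj_dominated:
  assumes "hilbert_operator s1 ip1 s ip A" "hilbert_operator s2 ip2 s ip B"
    and dom: "\<And>y. norm (hilbert_adjoint ip1 ip A y) \<le> C * norm (hilbert_adjoint ip2 ip B y)"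
  shows "range A \<subseteq> range B"
proof -
  interpret A: hilbert_operator s1 ip1 s ip A by fact
  interpret B: hilbert_operator s2 ip2 s ip B by fact
  have "A x \<in> range B" for x
  proof -
    have bound: "norm (ip y (A x)) \<le> (C * norm x) * norm (B.adj y)" for y
    proof -
      have "norm (ip y (A x)) \<le> norm (A.adj y) * norm x"
        unfolding A.ip_adj_left[symmetric] by (rule A.dom.Cauchy_Schwarz)
      also have "\<dots> \<le> (C * norm (B.adj y)) * norm x" by (intro mult_right_mono dom) simp
      finally show ?thesis by (simp add: mult_ac)
    qed
    obtain w where "\<And>y. ip y (A x) = ip2 (B.adj y) w"
      using B.dom.riesz_representation_dominated[OF B.linear_adj A.cod.linear_ip_left bound]
      by metis
    then have "A x = B w" by (intro A.cod.eqI_ip_right) (simp add: B.ip_adj_left)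
    then show ?thesis by blast
  qed
  then show ?thesis by blast
qed

text \<open>
  If \<open>z\<close> is orthogonal to the image under \<open>B\<^sub>2\<close> of the kernel of \<open>B\<^sub>1\<close>, then \<open>B\<^sub>2\<^sup>* z\<close> is orthogonal to
  that kernel, which is the orthogonal complement of the range of \<open>B\<^sub>1\<^sup>*\<close>.
\<close>

lemma mem_closure_image_kernel:
  assumes "hilbert_operator s2 ip2 s4 ip4 B1" "hilbert_operator s2 ip2 s5 ip5 B2"
    and orth: "\<And>z. hilbert_adjoint ip2 ip5 B2 z \<in> closure (range (hilbert_adjoint ip2 ip4 B1))
      \<Longrightarrow> ip5 x z = 0"
  shows "x \<in> closure (B2 ` {n. B1 n = 0})"
proof -
  interpret B1: hilbert_operator s2 ip2 s4 ip4 B1 by fact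
  interpret B2: hilbert_operator s2 ip2 s5 ip5 B2 by fact
  show ?thesis
  proof (rule B2.cod.mem_closure_if_orthogonal)
    show "B2.cod.subspace (B2 ` {n. B1 n = 0})"
      by (intro B2.subspace_image B1.subspace_kernel)
    fix z assume z: "\<And>y. y \<in> B2 ` {n. B1 n = 0} \<Longrightarrow> ip5 y z = 0"
    have "B2.adj z \<in> closure (range B1.adj)"
    proof (rule B1.dom.mem_closure_if_orthogonal[OF B1.subspace_range_adj])
      fix n assume "\<And>y. y \<in> range B1.adj \<Longrightarrow> ip2 y n = 0"
      then have "ip4 y (B1 n) = ip4 y 0" for y by (simp flip: B1.ip_adj_left)
      then have "B1 n = 0" by (rule B1.cod.eqI_ip_right)
      then have "ip2 n (B2.adj z) = 0" using z by (simp add: B2.ip_adj_right)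
      then show "ip2 (B2.adj z) n = 0" by (simp add: B1.dom.ip_eq_zero_commute)
    qed
    then show "ip5 x z = 0" by (rule orth)
  qed
qed

text \<open>
  The preimage hypothesis is what turns a \<open>z\<close> with \<open>B\<^sub>2\<^sup>* z\<close> merely in the closure of the range of
  \<open>B\<^sub>1\<^sup>*\<close> into the second component of a pair in the kernel of \<open>B\<^sup>*\<close>, to which the inclusion of kernels
  applies.
\<close>

lemma approximate_solution:
  assumes "hilbert_operator s1 ip1 s4 ip4 A1" "hilbert_operator s1 ip1 s5 ip5 A2"
    and "hilbert_operator s2 ip2 s4 ip4 B1" "hilbert_operator s2 ip2 s5 ip5 B2"
    and preimage: "hilbert_adjoint ip2 ip5 B2 -` closure (range (hilbert_adjoint ip2 ip4 B1))
      \<subseteq> hilbert_adjoint ip2 ip5 B2 -` range (hilbert_adjoint ip2 ip4 B1)"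
    and range: "range A1 \<subseteq> range B1"
    and kernel: "\<And>y z. hilbert_adjoint ip2 ip4 B1 y + hilbert_adjoint ip2 ip5 B2 z = 0
      \<Longrightarrow> hilbert_adjoint ip1 ip4 A1 y + hilbert_adjoint ip1 ip5 A2 z = 0"
    and "\<epsilon> > 0"
  obtains h' where "A1 h = B1 h'" "norm (A2 h - B2 h') \<le> \<epsilon>"
proof -
  interpret A1: hilbert_operator s1 ip1 s4 ip4 A1 by fact
  interpret A2: hilbert_operator s1 ip1 s5 ip5 A2 by fact
  interpret B1: hilbert_operator s2 ip2 s4 ip4 B1 by fact
  interpret B2: hilbert_operator s2 ip2 s5 ip5 B2 by fact
  obtain g where g: "A1 h = B1 g" using range by blast
  have "A2 h - B2 g \<in> closure (B2 ` {n. B1 n = 0})"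
  proof (rule mem_closure_image_kernel[OF assms(3,4)])
    fix z assume "B2.adj z \<in> closure (range B1.adj)"
    then obtain y where y: "B2.adj z = B1.adj y" using preimage by blast
    interpret adj: Vector_Spaces.linear s4 s2 B1.adj by (rule B1.linear_adj)
    have "B1.adj (- y) + B2.adj z = 0" using y by (simp add: adj.neg)
    then have "A1.adj (- y) + A2.adj z = 0" by (rule kernel)
    then have "ip1 h (A1.adj (- y) + A2.adj z) = 0" by simp
    then have "ip5 (A2 h) z = - ip4 (B1 g) (- y)"
      using g by (simp add: A1.dom.ip_add_right A1.ip_adj_right A2.ip_adj_right
          eq_neg_iff_add_eq_0 add.commute)
    also have "\<dots> = ip4 (B1 g) y"
      using A1.cod.ip_diff_right[of "B1 g" 0 y] by simp
    also have "\<dots> = ip5 (B2 g) z"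
      using y by (simp flip: B1.ip_adj_right B2.ip_adj_right)
    finally show "ip5 (A2 h - B2 g) z = 0" by (simp add: A2.cod.ip_diff_left)
  qed
  then obtain n where n: "B1 n = 0" "dist (B2 n) (A2 h - B2 g) < \<epsilon>"
    unfolding closure_approachable using \<open>\<epsilon> > 0\<close> by blast
  show thesis
  proof
    show "A1 h = B1 (g + n)" using g n(1) by (simp add: B1.add)
    show "norm (A2 h - B2 (g + n)) \<le> \<epsilon>"
      using n(2) by (simp add: B2.add dist_norm norm_minus_commute algebra_simps)
  qed
qed

theorem proposition2p4:
  fixes s1 :: "'k::real_or_complex \<Rightarrow> 'h1::banach \<Rightarrow> 'h1" and ip1 :: "'h1 \<Rightarrow> 'h1 \<Rightarrow> 'k"
    and s2 :: "'k \<Rightarrow> 'h2::banach \<Rightarrow> 'h2" and ip2 :: "'h2 \<Rightarrow> 'h2 \<Rightarrow> 'k"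
    and s4 :: "'k \<Rightarrow> 'h4::banach \<Rightarrow> 'h4" and ip4 :: "'h4 \<Rightarrow> 'h4 \<Rightarrow> 'k"
    and s5 :: "'k \<Rightarrow> 'h5::banach \<Rightarrow> 'h5" and ip5 :: "'h5 \<Rightarrow> 'h5 \<Rightarrow> 'k"
    and A1 :: "'h1 \<Rightarrow> 'h4" and A2 :: "'h1 \<Rightarrow> 'h5"
    and B1 :: "'h2 \<Rightarrow> 'h4" and B2 :: "'h2 \<Rightarrow> 'h5"
    and A :: "'h1 \<Rightarrow> 'h4 \<times> 'h5" and B :: "'h2 \<Rightarrow> 'h4 \<times> 'h5"
  assumes "hilbert_space s1 ip1" and "hilbert_space s2 ip2"
    and "hilbert_space s4 ip4" and "hilbert_space s5 ip5"
    and "continuous_linear s1 s4 A1" and "continuous_linear s1 s5 A2"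
    and "continuous_linear s2 s4 B1" and "continuous_linear s2 s5 B2"
    and "A = (\<lambda>h1. (A1 h1, A2 h1))" and "B = (\<lambda>h2. (B1 h2, B2 h2))"
    and "hilbert_adjoint ip2 ip5 B2 -` range (hilbert_adjoint ip2 ip4 B1)
       = hilbert_adjoint ip2 ip5 B2 -` closure (range (hilbert_adjoint ip2 ip4 B1))"
    and "((\<exists>C>0. \<forall>h4. norm (hilbert_adjoint ip1 ip4 A1 h4) \<le> C * norm (hilbert_adjoint ip2 ip4 B1 h4))
          \<and> {p. hilbert_adjoint ip2 (prod_ip ip4 ip5) B p = 0}
             \<subseteq> {p. hilbert_adjoint ip1 (prod_ip ip4 ip5) A p = 0})
       \<or> (((\<exists>C1. continuous_linear s1 s2 C1 \<and> A1 = B1 \<circ> C1)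
            \<or> (\<exists>D1. continuous_linear s2 s1 D1
                  \<and> hilbert_adjoint ip1 ip4 A1 = D1 \<circ> hilbert_adjoint ip2 ip4 B1))
          \<and> (\<exists>D. Vector_Spaces.linear s2 s1 D
                \<and> hilbert_adjoint ip1 (prod_ip ip4 ip5) A
                   = D \<circ> hilbert_adjoint ip2 (prod_ip ip4 ip5) B))"
  shows "\<forall>h1. \<forall>\<epsilon>>0. \<exists>h2. A1 h1 = B1 h2 \<and> norm (A2 h1 - B2 h2) \<le> \<epsilon>"
proof -
  note op = hilbert_operatorI
  interpret A1: hilbert_operator s1 ip1 s4 ip4 A1 using assms by (intro op)
  interpret A2: hilbert_operator s1 ip1 s5 ip5 A2 using assms by (intro op)
  interpret B1: hilbert_operator s2 ip2 s4 ip4 B1 using assms by (intro op)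
  interpret B2: hilbert_operator s2 ip2 s5 ip5 B2 using assms by (intro op)
  note ops = A1.hilbert_operator_axioms A2.hilbert_operator_axioms
    B1.hilbert_operator_axioms B2.hilbert_operator_axioms
  have adj_A: "hilbert_adjoint ip1 (prod_ip ip4 ip5) A = (\<lambda>p. A1.adj (fst p) + A2.adj (snd p))"
    unfolding assms(9) by (rule hilbert_adjoint_Pair[OF ops(1,2)])
  have adj_B: "hilbert_adjoint ip2 (prod_ip ip4 ip5) B = (\<lambda>p. B1.adj (fst p) + B2.adj (snd p))"
    unfolding assms(10) by (rule hilbert_adjoint_Pair[OF ops(3,4)])
  have dominated: "range A1 \<subseteq> range B1" if "\<And>y. norm (A1.adj y) \<le> C * norm (B1.adj y)" for C
    by (rule range_subset_if_adj_dominated[OF ops(1,3) that])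
  \<comment> \<open>In (ii), \<open>A\<^sup>* = D B\<^sup>*\<close> gives the inclusion of kernels just by \<open>D 0 = 0\<close>, while \<open>C\<^sub>1\<close> provides exact
    solutions outright and \<open>D\<^sub>1\<close>, being bounded, provides the domination in (i).\<close>
  have "range A1 \<subseteq> range B1
    \<and> (\<forall>p. B1.adj (fst p) + B2.adj (snd p) = 0 \<longrightarrow> A1.adj (fst p) + A2.adj (snd p) = 0)"
    using assms(12) unfolding adj_A adj_B
  proof (elim disjE conjE exE)
    fix C assume "\<forall>y. norm (A1.adj y) \<le> C * norm (B1.adj y)"
      and "{p. B1.adj (fst p) + B2.adj (snd p) = 0} \<subseteq> {p. A1.adj (fst p) + A2.adj (snd p) = 0}"
    then show ?thesis using dominated[of C] by blast
  next
    fix C1 D assume "A1 = B1 \<circ> C1" and D: "Vector_Spaces.linear s2 s1 D"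
      "(\<lambda>p. A1.adj (fst p) + A2.adj (snd p)) = D \<circ> (\<lambda>p. B1.adj (fst p) + B2.adj (snd p))"
    interpret D: Vector_Spaces.linear s2 s1 D by fact
    show ?thesis using \<open>A1 = B1 \<circ> C1\<close> fun_cong[OF D(2)] by auto
  next
    fix D1 D assume D1: "continuous_linear s2 s1 D1" "A1.adj = D1 \<circ> B1.adj"
      and D: "Vector_Spaces.linear s2 s1 D"
      "(\<lambda>p. A1.adj (fst p) + A2.adj (snd p)) = D \<circ> (\<lambda>p. B1.adj (fst p) + B2.adj (snd p))"
    interpret D: Vector_Spaces.linear s2 s1 D by fact
    obtain K where "\<And>x. norm (D1 x) \<le> K * norm x"
      using continuous_linear_bounded[OF assms(2,1) D1(1)] by blast
    then have "range A1 \<subseteq> range B1" by (intro dominated[of K]) (simp add: D1(2))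
    then show ?thesis using fun_cong[OF D(2)] by auto
  qed
  then have range: "range A1 \<subseteq> range B1"
    and kernel: "\<And>y z. B1.adj y + B2.adj z = 0 \<Longrightarrow> A1.adj y + A2.adj z = 0"
    by auto
  show ?thesis
    using approximate_solution[OF ops equalityD2[OF assms(11)] range kernel] by metis
qed

end
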